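(* For all $*\in\{\square,\boxtimes,\circ\}$ (the Cartesian, strong, and lexicographic products), if $\mathcal{G}$ and $\mathcal{H}$ are graph classes with positive vertex expansion, then there exists a constant $c>0$ such that every graph $G*H\in\mathcal{G}*\mathcal{H}$ has a subgraph $S$ with $\operatorname{tw}(S)\geq c\,|V(G*H)|$, hence $|V(S)|\geq c\,|V(G*H)|-1$, and $\varphi(S)\geq c$.
   Context: All graphs are simple, finite and undirected. For a graph $G$ and $X\subseteq V(G)$, let $N_G(X)=\bigcup_{x\in X}N_G(x)\setminus X$. The vertex expansion of a graph $G$ is $$\varphi(G)=\min_{X\subseteq V(G)\,:\,0<|X|\leq \frac12|V(G)|}\frac{|N_G(X)|}{|X|}.$$ The vertex expansion of a graph class $\mathcal{G}$ is $\varphi(\mathcal{G})=\inf_{G\in\mathcal{G}}\varphi(G)$; the class has positive vertex expansion if $\varphi(\mathcal{G})>0$. For graph classes $\mathcal{G}$ and $\mathcal{H}$ and $*\in\{\square,\boxtimes,\circ\}$, define $\mathcal{G}*\mathcal{H}=\{G*H : G\in\mathcal{G}, H\in\mathcal{H}\}$. A tree-decomposition of a graph $G$ is a pair $(T,\beta)$ consisting of a tree $T$ and a function $\beta:V(T)\to 2^{V(G)}$ such that (i) for every $v\in V(G)$, the set $\{t\in V(T): v\in\beta(t)\}$ is non-empty and induces a connected subgraph of $T$; and (ii) for every edge $uv\in E(G)$ there is $t\in V(T)$ with $\{u,v\}\subseteq\beta(t)$. Its width is $\max_{t\in V(T)}|\beta(t)|-1$. The treewidth $\operatorname{tw}(G)$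 is the minimum width of a tree-decomposition of $G$. All three products of $G$ and $H$ have vertex set $V(G)\times V(H)$. In the Cartesian product $G\,\square\, H$, $(g_1,h_1)(g_2,h_2)$ is an edge iff $g_1=g_2$ and $h_1h_2\in E(H)$; or $g_1g_2\in E(G)$ and $h_1=h_2$. In the strong product $G\boxtimes H$, it is an edge iff it is an edge of $G\,\square\, H$, or $g_1g_2\in E(G)$ and $h_1h_2\in E(H)$. In the lexicographic product $G\circ H$, it is an edge iff $g_1g_2\in E(G)$; or $g_1=g_2$ and $h_1h_2\in E(H)$. *)

theory Defs
  imports "Graph_Theory.Graph_Theory" "HOL-Library.Extended_Real"
begin

text \<open>
  Simple finite undirected graphs are the \<^locale>\<open>pair_graph\<close>s of the Graph Theory library: finite
  loop-free digraphs without parallel arcs whose arc relation is symmetric, an undirected edge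
  \<open>uv\<close> being the pair of arcs \<open>(u, v)\<close> and \<open>(v, u)\<close>.
\<close>

section \<open>Vertex expansion\<close>

definition open_nbhd :: "'a pair_pre_digraph \<Rightarrow> 'a set \<Rightarrow> 'a set" where
  "open_nbhd G X = parcs G `` X - X"

text \<open>
  The infimum is over a finite set of quotients, hence a minimum whenever that set is non-empty,
  that is, whenever \<open>G\<close> has at least two vertices.  For the graphs with at most one vertex, where the
  minimum does not exist, the value is \<open>\<infinity>\<close>; likewise for the empty class.
\<close>

definition vertex_expansion :: "'a pair_pre_digraph \<Rightarrow> ereal" where
  "vertex_expansion G =
     (INF X \<in> {X. X \<subseteq> pverts G \<and> 0 < card X \<and> real (card X) \<le> real (card (pverts G)) / 2}.
        ereal (real (card (open_nbhd G X)) / real (card X)))"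

definition class_vertex_expansion :: "'a pair_pre_digraph set \<Rightarrow> ereal" where
  "class_vertex_expansion \<G> = (INF G \<in> \<G>. vertex_expansion G)"

definition positive_vertex_expansion :: "'a pair_pre_digraph set \<Rightarrow> bool" where
  "positive_vertex_expansion \<G> \<longleftrightarrow> class_vertex_expansion \<G> > 0"


section \<open>Treewidth\<close>

text \<open>
  The library's \<^const>\<open>tree\<close> is about graphs with one arc per edge: in a symmetric digraph
  the closed walk \<open>u, v, u\<close> counts as a \<^const>\<open>pre_digraph.cycle\<close>.  The cycles of the undirected
  graph are those of length at least 3.
\<close>

definition undirected_tree :: "'t pair_pre_digraph \<Rightarrow> bool" where
  "undirected_tree T \<longleftrightarrow>
     pair_graph T \<and> connected (with_proj T) \<and>
     \<not> (\<exists>p. pre_digraph.cycle (with_proj T) p \<and> 3 \<le> length p)"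

definition tree_decomposition ::
    "'a pair_pre_digraph \<Rightarrow> 't pair_pre_digraph \<Rightarrow> ('t \<Rightarrow> 'a set) \<Rightarrow> bool" where
  "tree_decomposition G T \<beta> \<longleftrightarrow>
     undirected_tree T \<and>
     (\<forall>t \<in> pverts T. \<beta> t \<subseteq> pverts G) \<and>
     (\<forall>v \<in> pverts G. {t \<in> pverts T. v \<in> \<beta> t} \<noteq> {} \<and>
        connected (with_proj T \<restriction> {t \<in> pverts T. v \<in> \<beta> t})) \<and>
     (\<forall>(u, v) \<in> parcs G. \<exists>t \<in> pverts T. {u, v} \<subseteq> \<beta> t)"

definition decomposition_width :: "'t pair_pre_digraph \<Rightarrow> ('t \<Rightarrow> 'a set) \<Rightarrow> int" where
  "decomposition_width T \<beta> = int (Max ((\<lambda>t. card (\<beta> t)) ` pverts T)) - 1"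

text \<open>
  Every finite tree is isomorphic to one with vertices in \<^typ>\<open>nat\<close>.  Widths are integers bounded
  below by \<open>-1\<close>, so the infimum is attained.
\<close>

definition treewidth :: "'a pair_pre_digraph \<Rightarrow> int" where
  "treewidth G =
     Inf {decomposition_width T \<beta> | (T :: nat pair_pre_digraph) \<beta>. tree_decomposition G T \<beta>}"


section \<open>Graph products\<close>

definition cartesian_product ::
    "'a pair_pre_digraph \<Rightarrow> 'b pair_pre_digraph \<Rightarrow> ('a \<times> 'b) pair_pre_digraph" where
  "cartesian_product G H =
     \<lparr> pverts = pverts G \<times> pverts H,
       parcs = {((g1, h1), (g2, h2)) |g1 h1 g2 h2.
         (g1 \<in> pverts G \<and> g1 = g2 \<and> (h1, h2) \<in> parcs H) \<or>
         ((g1, g2) \<in> parcs G \<and> h1 \<in> pverts H \<and> h1 = h2)} \<rparr>"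

definition strong_product ::
    "'a pair_pre_digraph \<Rightarrow> 'b pair_pre_digraph \<Rightarrow> ('a \<times> 'b) pair_pre_digraph" where
  "strong_product G H =
     \<lparr> pverts = pverts G \<times> pverts H,
       parcs = parcs (cartesian_product G H) \<union>
         {((g1, h1), (g2, h2)) |g1 h1 g2 h2. (g1, g2) \<in> parcs G \<and> (h1, h2) \<in> parcs H} \<rparr>"

definition lexicographic_product ::
    "'a pair_pre_digraph \<Rightarrow> 'b pair_pre_digraph \<Rightarrow> ('a \<times> 'b) pair_pre_digraph" where
  "lexicographic_product G H =
     \<lparr> pverts = pverts G \<times> pverts H,
       parcs = {((g1, h1), (g2, h2)) |g1 h1 g2 h2.
         ((g1, g2) \<in> parcs G \<and> h1 \<in> pverts H \<and> h2 \<in> pverts H) \<or>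
         (g1 \<in> pverts G \<and> g1 = g2 \<and> (h1, h2) \<in> parcs H)} \<rparr>"

definition class_product ::
    "('a pair_pre_digraph \<Rightarrow> 'b pair_pre_digraph \<Rightarrow> ('a \<times> 'b) pair_pre_digraph) \<Rightarrow>
     'a pair_pre_digraph set \<Rightarrow> 'b pair_pre_digraph set \<Rightarrow> ('a \<times> 'b) pair_pre_digraph set" where
  "class_product pr \<G> \<H> = {pr G H |G H. G \<in> \<G> \<and> H \<in> \<H>}"

lemma pair_graph_iff:
  "pair_graph G \<longleftrightarrow>
     finite (pverts G) \<and> parcs G \<subseteq> pverts G \<times> pverts G \<and> sym (parcs G) \<and> irrefl (parcs G)"
proof
  assume "pair_graph G"
  then interpret pair_graph G .
  show "finite (pverts G) \<and> parcs G \<subseteq> pverts G \<times> pverts G \<and> sym (parcs G) \<and> irrefl (parcs G)"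
    using pair_finite_verts pair_sym_arcs pair_no_loops wellformed'
    by (fastforce simp: symmetric_def irrefl_def)
next
  assume *: "finite (pverts G) \<and> parcs G \<subseteq> pverts G \<times> pverts G \<and> sym (parcs G) \<and> irrefl (parcs G)"
  then have "finite (parcs G)" by (meson finite_SigmaI finite_subset)
  with * show "pair_graph G"
    by unfold_locales (auto simp: symmetric_def irrefl_def)
qed

lemma pair_graph_products:
  assumes "pair_graph G" "pair_graph H"
    and "pr \<in> {cartesian_product, strong_product, lexicographic_product}"
  shows "pair_graph (pr G H)"
  using assms unfolding pair_graph_iff
  by (auto simp: cartesian_product_def strong_product_def lexicographic_product_def
      sym_def irrefl_def)

end

theory Submission
  imports Defs
begin

text \<open>
  The Cartesian product is a spanning subgraph of all three products, so it serves as \<open>S\<close>.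

  It expands: for a set \<open>X\<close> of at most half of the vertices, a row that \<open>X\<close> meets in at most nine
  tenths of its vertices contributes a proportional share to the boundary of \<open>X\<close>.  If \<open>X\<close> did not
  expand, then nine tenths of it would lie in the remaining, nearly full rows, likewise nine tenths
  in nearly full columns, so that both the number of nearly full rows and that of nearly full columns
  would be so large that \<open>X\<close> has more than half of the vertices.

  Its treewidth is linear: every tree-decomposition has a bag whose removal leaves only pieces with at
  most half of the vertices.  Unless the bag itself is large, some union of pieces has between a sixth
  and a half of the vertices, and its boundary lies in the bag, which is therefore large by expansion.
\<close>

section \<open>Expansion of Cartesian products\<close>

text \<open>Multiplied out, so that the empty set needs no exclusion. A graph with at most one
  vertex, whose \<open>vertex_expansion\<close> is infinite, expands with every
  \<open>k\<close>.\<close>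

definition expands :: "real \<Rightarrow> 'a pair_pre_digraph \<Rightarrow> bool" where
  "expands k G \<longleftrightarrow> (\<forall>X \<subseteq> pverts G. 2 * card X \<le> card (pverts G) \<longrightarrow>
     k * real (card X) \<le> real (card (open_nbhd G X)))"

lemma expands_iff_vertex_expansion:
  "expands k G \<longleftrightarrow> ereal k \<le> vertex_expansion G"
proof -
  have "(2 * card X \<le> card (pverts G) \<longrightarrow> k * real (card X) \<le> real (card (open_nbhd G X))) \<longleftrightarrow>
      (0 < card X \<and> real (card X) \<le> real (card (pverts G)) / 2 \<longrightarrow>
       ereal k \<le> ereal (real (card (open_nbhd G X)) / real (card X)))" for X
  proof (cases "0 < card X")
    case True
    moreover have "real (card X) \<le> real (card (pverts G)) / 2 \<longleftrightarrow> 2 * card X \<le> card (pverts G)"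
      by linarith
    ultimately show ?thesis by (simp add: pos_le_divide_eq)
  qed simp
  then show ?thesis
    unfolding expands_def vertex_expansion_def le_INF_iff by auto
qed

lemma expands_mono: "expands k G \<Longrightarrow> l \<le> k \<Longrightarrow> expands l G"
  unfolding expands_def by (meson mult_right_mono of_nat_0_le_iff order_trans)

lemma open_nbhd_subset_pverts: "pair_graph G \<Longrightarrow> open_nbhd G X \<subseteq> pverts G"
  unfolding pair_graph_iff open_nbhd_def by blast

text \<open>Passes from half to nine tenths of the vertices at the cost of a factor 20. If
  \<open>X\<close> has more than half, the set \<open>Y\<close> of vertices neither in
  \<open>X\<close> nor adjacent to it has less than half, and its boundary lies in that of
  \<open>X\<close>. So both parts of the complement of \<open>X\<close> are controlled by the
  boundary of \<open>X\<close>.\<close>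

lemma expands_large:
  assumes G: "pair_graph G" and exp: "expands k G" and k: "0 < k" "k \<le> 1"
    and X: "X \<subseteq> pverts G" "10 * card X \<le> 9 * card (pverts G)"
  shows "k / 20 * real (card X) \<le> real (card (open_nbhd G X))"
proof (cases "2 * card X \<le> card (pverts G)")
  case True
  then have "k * real (card X) \<le> real (card (open_nbhd G X))"
    using exp X(1) by (simp add: expands_def)
  moreover have "k / 20 * real (card X) \<le> k * real (card X)"
    using k(1) by (simp add: mult_right_mono)
  ultimately show ?thesis by linarith
next
  case False
  define Y where "Y = pverts G - X - open_nbhd G X"
  have fin: "finite (pverts G)" using G by (simp add: pair_graph_iff)
  have N: "open_nbhd G X \<subseteq> pverts G" using open_nbhd_subset_pverts[OF G] .
  have "pverts G = X \<union> open_nbhd G X \<union> Y" using X(1) N by (auto simp: Y_def)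
  moreover have "X \<inter> open_nbhd G X = {}" "(X \<union> open_nbhd G X) \<inter> Y = {}"
    by (auto simp: Y_def open_nbhd_def)
  moreover have "finite X" "finite (open_nbhd G X)" "finite Y"
    using fin X(1) N by (auto simp: Y_def intro: finite_subset)
  ultimately have card: "card (pverts G) = card X + card (open_nbhd G X) + card Y"
    by (metis card_Un_disjoint finite_Un)
  have "open_nbhd G Y \<subseteq> open_nbhd G X"
    using G unfolding pair_graph_iff open_nbhd_def Y_def sym_def by blast
  then have "card (open_nbhd G Y) \<le> card (open_nbhd G X)"
    using \<open>finite (open_nbhd G X)\<close> by (rule card_mono[rotated])
  moreover have "k * real (card Y) \<le> real (card (open_nbhd G Y))"
    using exp[unfolded expands_def, rule_format, of Y] False card by (auto simp: Y_def)
  ultimately have "k * real (card Y) \<le> real (card (open_nbhd G X))"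
    by linarith
  moreover have "k * real (card (open_nbhd G X)) \<le> real (card (open_nbhd G X))"
    using k by (simp add: mult_left_le_one_le)
  \<comment> \<open>The complement of \<open>X\<close> has at least \<open>card X / 9\<close>
    vertices; a tenth suffices.\<close>
  moreover have "k * (real (card X) / 10) \<le> k * (real (card (open_nbhd G X)) + real (card Y))"
    using card X(2) k(1) by (intro mult_left_mono) linarith+
  ultimately show ?thesis by (simp add: algebra_simps)
qed

text \<open>Rows outside \<open>F\<close> expand by \<open>expands_large\<close>, and boundaries in
  different rows are disjoint. If more than a tenth of \<open>X\<close> lies in such rows,
  \<open>N\<close> therefore has at least \<open>k / 20\<close> times a tenth of
  \<open>card X\<close> elements. Keeping \<open>X\<close> and \<open>N\<close> mere relations lets
  the lemma serve columns too, via converses.\<close>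

lemma full_rows_or_expansion:
  fixes X N :: "('a \<times> 'b) set"
  assumes H: "pair_graph H" and exp: "expands k H" and k: "0 < k" "k \<le> 1"
    and fin: "finite A" "finite N" and X: "X \<subseteq> A \<times> pverts H"
    and N: "\<And>g. g \<in> A \<Longrightarrow> open_nbhd H (X `` {g}) \<subseteq> N `` {g}"
  defines "F \<equiv> {g \<in> A. 9 * card (pverts H) < 10 * card (X `` {g})}"
  shows "k / 200 * real (card X) \<le> real (card N) \<or> 9 * card X \<le> 10 * card (X \<inter> F \<times> UNIV)"
proof (rule disjCI)
  assume few: "\<not> 9 * card X \<le> 10 * card (X \<inter> F \<times> UNIV)"
  define Y where "Y = Sigma (A - F) (\<lambda>g. X `` {g})"
  have finH: "finite (pverts H)" using H by (simp add: pair_graph_iff)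
  have rows: "X `` {g} \<subseteq> pverts H" for g using X by auto
  have finX: "finite X" using X fin(1) finH by (meson finite_SigmaI finite_subset)
  have "X = X \<inter> F \<times> UNIV \<union> Y" using X by (auto simp: Y_def)
  then have "card X \<le> card (X \<inter> F \<times> UNIV) + card Y" by (metis card_Un_le)
  with few have Y: "real (card X) \<le> 10 * real (card Y)" by linarith
  have "k / 200 * real (card X) \<le> k / 20 * real (card Y)"
    using mult_left_mono[OF Y, of "k / 200"] k(1) by simp
  also have "k / 20 * real (card Y) = (\<Sum>g\<in>A - F. k / 20 * real (card (X `` {g})))"
    using fin(1) finite_subset[OF rows finH]
    by (simp add: Y_def sum_distrib_left)
  also have "\<dots> \<le> (\<Sum>g\<in>A - F. real (card (open_nbhd H (X `` {g}))))"
    using rows by (intro sum_mono expands_large[OF H exp k]) (auto simp: F_def)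
  also have "\<dots> = real (card (Sigma (A - F) (\<lambda>g. open_nbhd H (X `` {g}))))"
    using fin(1) finite_subset[OF open_nbhd_subset_pverts[OF H] finH]
    by (subst card_SigmaI) auto
  also have "\<dots> \<le> real (card N)"
    using N fin(2) by (intro of_nat_mono card_mono) auto
  finally show "k / 200 * real (card X) \<le> real (card N)" .
qed

lemma card_full_rows:
  assumes "finite X" "finite A" "\<And>g. g \<in> A \<Longrightarrow> 9 * n \<le> 10 * card (X `` {g})"
  shows "9 * (card A * n) \<le> 10 * card X"
proof -
  have "9 * (card A * n) = (\<Sum>g\<in>A. 9 * n)" by simp
  also have "\<dots> \<le> (\<Sum>g\<in>A. 10 * card (X `` {g}))" using assms(3) by (rule sum_mono)
  also have "\<dots> = 10 * card (Sigma A (\<lambda>g. X `` {g}))"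
    using assms(1,2) by (simp add: sum_distrib_left)
  also have "\<dots> \<le> 10 * card X"
    using assms(1) by (intro mult_le_mono2 card_mono) auto
  finally show ?thesis .
qed

text \<open>Let \<open>m\<close> be the number of vertices of the product. Without expansion, eight
  tenths of \<open>X\<close> lie in \<open>A \<times> B\<close>, so \<open>card A * card B\<close>
  is at least 0.8 \<open>card X\<close>. Counting along the nearly full rows and columns bounds
  \<open>card X\<close> below by 0.9 \<open>card A * card (pverts H)\<close> and by 0.9
  \<open>card B * card (pverts G)\<close>. Multiplying the two gives \<open>card X\<close> at least
  0.648 \<open>m\<close>, which is more than half.\<close>

lemma expands_cartesian_product:
  fixes G :: "'a pair_pre_digraph" and H :: "'b pair_pre_digraph"
  assumes G: "pair_graph G" "expands k G" and H: "pair_graph H" "expands k H"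
    and k: "0 < k" "k \<le> 1"
  shows "expands (k / 200) (cartesian_product G H)"
  unfolding expands_def
proof (intro allI impI)
  let ?P = "cartesian_product G H"
  fix X
  assume "X \<subseteq> pverts ?P" and "2 * card X \<le> card (pverts ?P)"
  then have X: "X \<subseteq> pverts G \<times> pverts H" "2 * card X \<le> card (pverts G) * card (pverts H)"
    by (auto simp: cartesian_product_def card_cartesian_product)
  let ?N = "open_nbhd ?P X"
  have fin: "finite (pverts G)" "finite (pverts H)" using G H by (auto simp: pair_graph_iff)
  have finX: "finite X" using X fin by (meson finite_SigmaI finite_subset)
  have "pair_graph ?P" using pair_graph_products[OF G(1) H(1)] by blast
  then have finN: "finite ?N"
    using open_nbhd_subset_pverts finite_subset unfolding pair_graph_iff by metis
  have "((g, h), (g, h')) \<in> parcs ?P" if "g \<in> pverts G" "(h, h') \<in> parcs H" for g h h'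
    using that by (simp add: cartesian_product_def)
  then have row: "open_nbhd H (X `` {g}) \<subseteq> ?N `` {g}" if "g \<in> pverts G" for g
    using that unfolding open_nbhd_def by blast
  have "((g, h), (g', h)) \<in> parcs ?P" if "h \<in> pverts H" "(g, g') \<in> parcs G" for g g' h
    using that by (simp add: cartesian_product_def)
  then have col: "open_nbhd G (X\<inverse> `` {h}) \<subseteq> ?N\<inverse> `` {h}" if "h \<in> pverts H" for h
    using that unfolding open_nbhd_def by blast
  define A where "A = {g \<in> pverts G. 9 * card (pverts H) < 10 * card (X `` {g})}"
  define B where "B = {h \<in> pverts H. 9 * card (pverts G) < 10 * card (X\<inverse> `` {h})}"
  show "k / 200 * real (card X) \<le> real (card ?N)"
  proof (rule ccontr)
    assume small: "\<not> ?thesis"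
    then have pos: "0 < card X" by (cases "card X = 0") auto
    have A: "9 * card X \<le> 10 * card (X \<inter> A \<times> UNIV)"
      using full_rows_or_expansion[OF H k fin(1) finN X(1) row] small by (auto simp: A_def)
    \<comment> \<open>The columns of \<open>X\<close> are the rows of its converse.\<close>
    have "X\<inverse> \<subseteq> pverts H \<times> pverts G" using X(1) by auto
    then have "9 * card (X\<inverse>) \<le> 10 * card (X\<inverse> \<inter> B \<times> UNIV)"
      using full_rows_or_expansion[OF G k fin(2) _ _ col] small finN by (auto simp: B_def)
    moreover have "X\<inverse> \<inter> B \<times> UNIV = (X \<inter> UNIV \<times> B)\<inverse>" by auto
    ultimately have B: "9 * card X \<le> 10 * card (X \<inter> UNIV \<times> B)" by simp
    \<comment> \<open>Two subsets of \<open>X\<close> with nine tenths of it each meet in at least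
      eight tenths.\<close>
    have "card (X \<inter> A \<times> UNIV) + card (X \<inter> UNIV \<times> B) =
        card (X \<inter> A \<times> UNIV \<union> X \<inter> UNIV \<times> B) + card (X \<inter> A \<times> UNIV \<inter> (X \<inter> UNIV \<times> B))"
      using finX by (intro card_Un_Int) auto
    moreover have "card (X \<inter> A \<times> UNIV \<union> X \<inter> UNIV \<times> B) \<le> card X"
      using finX by (intro card_mono) auto
    moreover have "card (X \<inter> A \<times> UNIV \<inter> (X \<inter> UNIV \<times> B)) \<le> card (A \<times> B)"
      using fin by (intro card_mono) (auto simp: A_def B_def)
    ultimately have AB: "8 * card X \<le> 10 * (card A * card B)"
      using A B by (simp add: card_cartesian_product)
    have a: "9 * (card A * card (pverts H)) \<le> 10 * card X"
      using fin finX by (intro card_full_rows) (auto simp: A_def)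
    have "9 * (card B * card (pverts G)) \<le> 10 * card (X\<inverse>)"
      using fin finX by (intro card_full_rows) (auto simp: B_def)
    then have b: "9 * (card B * card (pverts G)) \<le> 10 * card X" by simp
    let ?x = "card X" and ?m = "card (pverts G) * card (pverts H)"
    \<comment> \<open>The chain bounds \<open>648 * ?x * ?m\<close> by \<open>500 * ?x * ?m\<close>,
      which forces \<open>?m = 0\<close>.\<close>
    have "81 * 8 * ?x * ?m \<le> 81 * 10 * (card A * card B) * ?m"
      using mult_le_mono1[OF AB, of "81 * ?m"] by (simp add: ac_simps)
    also have "\<dots> = 10 * ((9 * (card A * card (pverts H))) * (9 * (card B * card (pverts G))))"
      by (simp add: ac_simps)
    also have "\<dots> \<le> 10 * ((10 * ?x) * (10 * ?x))"
      by (intro mult_le_mono2 mult_le_mono a b)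
    also have "\<dots> = 500 * ?x * (2 * ?x)" by simp
    also have "\<dots> \<le> 500 * ?x * ?m" using X(2) by (intro mult_le_mono2)
    finally have "?m = 0" using pos by simp
    with X(2) pos show False by linarith
  qed
qed

section \<open>A central bag of a tree-decomposition\<close>

text \<open>A path from \<open>a\<close> to \<open>b\<close> off the edge has at least two arcs, and
  closing it with \<open>(b, a)\<close> gives a cycle of length at least 3.\<close>

lemma tree_edge_is_bridge:
  assumes T: "undirected_tree T" and e: "(a, b) \<in> parcs T"
  shows "(a, b) \<notin> (parcs T - {(a, b), (b, a)})\<^sup>*"
proof
  assume reach: "(a, b) \<in> (parcs T - {(a, b), (b, a)})\<^sup>*"
  define T' where "T' = \<lparr>pverts = pverts T, parcs = parcs T - {(a, b), (b, a)}\<rparr>"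
  have T_graph: "pair_graph T" using T by (simp add: undirected_tree_def)
  interpret T: pair_graph T by (fact T_graph)
  interpret T': pair_wf_digraph T'
    by unfold_locales (auto simp: T'_def dest: T.in_arcsD1 T.in_arcsD2)
  have V: "a \<in> pverts T" "b \<in> pverts T" using e T.in_arcsD1 T.in_arcsD2 by blast+
  have "a \<noteq> b" using e T_graph by (auto simp: pair_graph_iff irrefl_def)
  have "(a, b) \<in> rtrancl_on (pverts T') (parcs T')"
    using reach V by (intro rtrancl_consistent_rtrancl_on) (auto simp: T'_def T.in_arcsD2)
  then have "a \<rightarrow>\<^sup>*\<^bsub>T'\<^esub> b" by (simp add: reachable_def)
  then obtain p where p: "T'.apath a p b" using T'.reachable_apath by blast
  have "p \<noteq> []" using p \<open>a \<noteq> b\<close> by (auto simp: T'.apath_def T'.awalk_def)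
  \<comment> \<open>A path with a single arc would be the removed arc \<open>(a, b)\<close>.\<close>
  moreover have "p \<noteq> [x]" for x
    using p by (cases x) (auto simp: T'.apath_def T'.awalk_def, simp add: T'_def)
  ultimately have len: "2 \<le> length p"
    by (cases p; cases "tl p") auto
  have walk: "T.awalk a p b" and dist: "distinct (pawalk_verts a p)"
    using p by (auto simp: T'.apath_def T'.awalk_def T.awalk_def, auto simp: T'_def)
  have ba: "(b, a) \<in> parcs T" using e T_graph by (auto simp: pair_graph_iff sym_def)
  have "T.cycle ((b, a) # p)"
    unfolding T.cycle_def using walk dist ba V
    by (intro exI[of _ b]) (auto simp: T.awalk_Cons_iff)
  then show False using T len unfolding undirected_tree_def
    by (metis (no_types, lifting) Suc_le_mono length_Cons numeral_2_eq_2 numeral_3_eq_3)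
qed

text \<open>\<open>connected\<close> refers to the symmetric closure, which adds no arcs because
  \<open>T\<close> is symmetric. In terms of \<open>rtrancl\<close>, paths avoiding a node or an
  edge can be compared by monotonicity.\<close>

lemma connected_induced_reach:
  assumes "pair_graph T" "connected (with_proj T \<restriction> S)" "s \<in> S" "t \<in> S"
  shows "(s, t) \<in> (parcs T \<inter> S \<times> S)\<^sup>*"
proof -
  have "s \<rightarrow>\<^sup>*\<^bsub>mk_symmetric (with_proj T \<restriction> S)\<^esub> t"
    using assms by (auto simp: connected_def strongly_connected_def)
  then have "(s, t) \<in> (parcs (mk_symmetric (with_proj T \<restriction> S)))\<^sup>*"
    by (auto simp: reachable_def dest: rtrancl_on_rtranclI)
  moreover have "parcs (mk_symmetric (with_proj T \<restriction> S)) \<subseteq> parcs T \<inter> S \<times> S"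
    using assms(1) by (auto simp: parcs_mk_symmetric pair_graph_iff sym_def induce_subgraph_def)
  ultimately show ?thesis using rtrancl_mono by blast
qed

lemma undirected_tree_reach:
  assumes "undirected_tree T" "s \<in> pverts T" "t \<in> pverts T"
  shows "(s, t) \<in> (parcs T)\<^sup>*"
proof -
  have T: "pair_graph T" "connected (with_proj T)" using assms(1) by (auto simp: undirected_tree_def)
  then have "with_proj T \<restriction> pverts T = with_proj T"
    by (auto simp: induce_subgraph_def with_proj_def pair_graph_iff)
  then show ?thesis
    using connected_induced_reach[OF T(1), of "pverts T" s t] T(2) assms(2,3)
      rtrancl_mono[of "parcs T \<inter> pverts T \<times> pverts T" "parcs T"] by auto
qed

section \<open>Branches of a tree at a node\<close>

definition arcs_avoiding :: "'t pair_pre_digraph \<Rightarrow> 't \<Rightarrow> 't rel" where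
  "arcs_avoiding T b = parcs T \<inter> (- {b}) \<times> (- {b})"

text \<open>The component of \<open>t\<close> in the tree with \<open>b\<close> deleted; for
  \<open>t = b\<close> it is just \<open>{b}\<close>.\<close>

definition branch :: "'t pair_pre_digraph \<Rightarrow> 't \<Rightarrow> 't \<Rightarrow> 't set" where
  "branch T b t = (arcs_avoiding T b)\<^sup>* `` {t}"

lemma branch_not_centre: "t \<noteq> b \<Longrightarrow> b \<notin> branch T b t"
proof
  assume "t \<noteq> b" "b \<in> branch T b t"
  then have "(t, b) \<in> (arcs_avoiding T b)\<^sup>*" by (simp add: branch_def)
  then show False using \<open>t \<noteq> b\<close> by (cases rule: rtranclE) (auto simp: arcs_avoiding_def)
qed

lemma branch_subset_pverts:
  assumes "pair_graph T" "t \<in> pverts T"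
  shows "branch T b t \<subseteq> pverts T"
proof
  fix s assume "s \<in> branch T b t"
  then have "(t, s) \<in> (arcs_avoiding T b)\<^sup>*" by (simp add: branch_def)
  then show "s \<in> pverts T"
    by induction (use assms in \<open>auto simp: arcs_avoiding_def pair_graph_iff\<close>)
qed

text \<open>\<open>c\<close> is the node from which a path starting at \<open>t\<close> first enters
  \<open>b\<close>.\<close>

lemma branch_attachment:
  assumes "(t, b) \<in> (parcs T)\<^sup>*" "t \<noteq> b"
  obtains c where "c \<in> branch T b t" "(c, b) \<in> parcs T"
proof -
  have "t \<noteq> b \<longrightarrow> (\<exists>c. (t, c) \<in> (arcs_avoiding T b)\<^sup>* \<and> (c, b) \<in> parcs T)"
    using assms(1)
  proof (induction rule: converse_rtrancl_induct)
    case base then show ?case by simp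
  next
    case (step y z)
    show ?case
    proof (cases "z = b")
      case True then show ?thesis using step by blast
    next
      case False
      show ?thesis
      proof
        assume "y \<noteq> b"
        then have "(y, z) \<in> arcs_avoiding T b" using step False by (simp add: arcs_avoiding_def)
        then show "\<exists>c. (y, c) \<in> (arcs_avoiding T b)\<^sup>* \<and> (c, b) \<in> parcs T"
          using step.IH False by (meson converse_rtrancl_into_rtrancl)
      qed
    qed
  qed
  then show ?thesis using assms(2) that by (auto simp: branch_def)
qed

lemma sym_arcs_avoiding_rtrancl: "pair_graph T \<Longrightarrow> sym ((arcs_avoiding T b)\<^sup>*)"
  by (intro sym_rtrancl) (auto simp: arcs_avoiding_def pair_graph_iff sym_def)

lemma branch_sym:
  assumes "pair_graph T" "s \<in> branch T b t"
  shows "branch T b s = branch T b t"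
  using assms(2) sym_arcs_avoiding_rtrancl[OF assms(1), of b]
  unfolding branch_def by (auto dest: symD intro: rtrancl_trans)

text \<open>A piece of the graph after removal of the bag at \<open>b\<close>. It is a set; its
  cardinality acts as the weight of the branch.\<close>

definition branch_weight ::
    "'t pair_pre_digraph \<Rightarrow> ('t \<Rightarrow> 'a set) \<Rightarrow> 't \<Rightarrow> 't \<Rightarrow> 'a set" where
  "branch_weight T \<beta> b t = \<Union> (\<beta> ` branch T b t) - \<beta> b"

context
  fixes G :: "'a pair_pre_digraph" and T :: "'t pair_pre_digraph" and \<beta>
  assumes G: "pair_graph G" and td: "tree_decomposition G T \<beta>"
begin

lemma decomposition_tree: "undirected_tree T" "pair_graph T"
  using td by (auto simp: tree_decomposition_def undirected_tree_def)

lemma decomposition_tree_nonempty: "pverts T \<noteq> {}"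
  using decomposition_tree
  by (auto simp: undirected_tree_def connected_def strongly_connected_def)

lemma finite_decomposition_tree: "finite (pverts T)"
  using decomposition_tree(2) by (simp add: pair_graph_iff)

lemma bag_subset: "t \<in> pverts T \<Longrightarrow> \<beta> t \<subseteq> pverts G"
  using td by (simp add: tree_decomposition_def)

lemma bag_connected:
  assumes "v \<in> \<beta> s" "v \<in> \<beta> t" "s \<in> pverts T" "t \<in> pverts T"
  shows "(s, t) \<in> (parcs T \<inter> {t. v \<in> \<beta> t} \<times> {t. v \<in> \<beta> t})\<^sup>*"
proof -
  let ?S = "{t \<in> pverts T. v \<in> \<beta> t}"
  have "v \<in> pverts G" using bag_subset assms(1,3) by blast
  then have "connected (with_proj T \<restriction> ?S)" using td by (simp add: tree_decomposition_def)
  then have "(s, t) \<in> (parcs T \<inter> ?S \<times> ?S)\<^sup>*"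
    using connected_induced_reach[OF decomposition_tree(2)] assms by blast
  then show ?thesis by (rule rtrancl_mono[THEN subsetD, rotated]) auto
qed

text \<open>The path runs through bags containing \<open>v\<close>, so it misses \<open>b\<close>.
  Hence a vertex outside the bag at \<open>b\<close> occurs in only one branch at
  \<open>b\<close>.\<close>

lemma bag_path_avoiding:
  assumes "v \<in> \<beta> s" "v \<in> \<beta> t" "v \<notin> \<beta> b" "s \<in> pverts T" "t \<in> pverts T"
  shows "(s, t) \<in> (arcs_avoiding T b)\<^sup>*"
  using bag_connected[OF assms(1,2,4,5)]
  by (rule rtrancl_mono[THEN subsetD, rotated]) (use assms(3) in \<open>auto simp: arcs_avoiding_def\<close>)

lemma branch_weight_subset: "t \<in> pverts T \<Longrightarrow> branch_weight T \<beta> b t \<subseteq> pverts G"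
  using branch_subset_pverts[OF decomposition_tree(2)] bag_subset
  unfolding branch_weight_def by blast

text \<open>The ends of an edge share a bag, and if one end is in the piece, that bag belongs to the
  same branch. So the bag at \<open>b\<close> separates the piece from the rest of
  \<open>G\<close>.\<close>

lemma branch_weight_boundary:
  assumes "t \<in> pverts T"
  shows "parcs G `` branch_weight T \<beta> b t \<subseteq> branch_weight T \<beta> b t \<union> \<beta> b"
proof
  fix w assume "w \<in> parcs G `` branch_weight T \<beta> b t"
  then obtain u s where u: "(u, w) \<in> parcs G" "u \<notin> \<beta> b" "s \<in> branch T b t" "u \<in> \<beta> s"
    by (auto simp: branch_weight_def)
  obtain r where r: "r \<in> pverts T" "u \<in> \<beta> r" "w \<in> \<beta> r"
    using td u(1) unfolding tree_decomposition_def by fastforce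
  have "s \<in> pverts T" using branch_subset_pverts[OF decomposition_tree(2) assms] u(3) by blast
  then have "(s, r) \<in> (arcs_avoiding T b)\<^sup>*" using bag_path_avoiding u r by blast
  then have "r \<in> branch T b t" using u(3) by (auto simp: branch_def intro: rtrancl_trans)
  then show "w \<in> branch_weight T \<beta> b t \<union> \<beta> b" using r by (auto simp: branch_weight_def)
qed

text \<open>The branches lie on opposite sides of the edge between \<open>b\<close> and
  \<open>c\<close>. A common vertex \<open>v\<close> would give a walk from \<open>c\<close> to
  \<open>b\<close> off that edge: from \<open>c\<close> to \<open>r\<close> in the first branch,
  from \<open>r\<close> to \<open>s\<close> through bags containing \<open>v\<close>, from
  \<open>s\<close> to \<open>b\<close> in the second branch. But the edge is a bridge.\<close>

lemma opposite_branches_disjoint: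
  assumes bc: "(c, b) \<in> parcs T" and t: "t \<in> pverts T" "t' \<in> pverts T"
    and c: "c \<in> branch T b t" and b: "b \<in> branch T c t'"
  shows "branch_weight T \<beta> b t \<inter> branch_weight T \<beta> c t' = {}"
proof (rule ccontr)
  note T = decomposition_tree
  assume "branch_weight T \<beta> b t \<inter> branch_weight T \<beta> c t' \<noteq> {}"
  then obtain v r s where v: "r \<in> branch T b t" "v \<in> \<beta> r" "v \<notin> \<beta> b"
      "s \<in> branch T c t'" "v \<in> \<beta> s" "v \<notin> \<beta> c"
    by (auto simp: branch_weight_def)
  let ?E = "parcs T - {(c, b), (b, c)}"
  have sub: "(arcs_avoiding T b)\<^sup>* \<subseteq> ?E\<^sup>*" "(arcs_avoiding T c)\<^sup>* \<subseteq> ?E\<^sup>*"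
    by (intro rtrancl_mono; auto simp: arcs_avoiding_def)+
  have "(c, r) \<in> (arcs_avoiding T b)\<^sup>*"
    using branch_sym[OF T(2) c] v(1) by (auto simp: branch_def)
  moreover have "(r, s) \<in> (arcs_avoiding T b)\<^sup>*"
    using v t branch_subset_pverts[OF T(2)] by (blast intro: bag_path_avoiding)
  moreover have "(s, b) \<in> (arcs_avoiding T c)\<^sup>*"
    using branch_sym[OF T(2) v(4)] b by (auto simp: branch_def)
  ultimately have "(c, b) \<in> ?E\<^sup>*" using sub by (meson rtrancl_trans subsetD)
  then show False using tree_edge_is_bridge[OF T(1) bc] by simp
qed

text \<open>A branch at \<open>c\<close> without \<open>b\<close> is attached to \<open>c\<close>
  through a neighbour \<open>d\<close> other than \<open>b\<close>, so it stays within the branch at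
  \<open>b\<close> that contains \<open>c\<close>. It is smaller because it lacks
  \<open>c\<close>.\<close>

lemma branch_shrinks:
  assumes bc: "(c, b) \<in> parcs T" and t': "t' \<in> pverts T" "t' \<noteq> c"
    and c: "c \<in> branch T b t" "c \<noteq> b" and b: "b \<notin> branch T c t'"
  shows "branch T c t' \<subset> branch T b t"
proof
  note T = decomposition_tree
  have "c \<in> pverts T" using bc T(2) by (auto simp: pair_graph_iff)
  then have "(t', c) \<in> (parcs T)\<^sup>*" using undirected_tree_reach[OF T(1)] t'(1) by blast
  then obtain d where d: "d \<in> branch T c t'" "(d, c) \<in> parcs T"
    using branch_attachment t'(2) by metis
  have "d \<noteq> b" using d b by blast
  then have cd: "(c, d) \<in> arcs_avoiding T b"
    using d(2) c(2) T(2) by (auto simp: arcs_avoiding_def pair_graph_iff sym_def)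
  show "branch T c t' \<subseteq> branch T b t"
  proof
    fix s assume "s \<in> branch T c t'"
    then have "(d, s) \<in> (arcs_avoiding T c)\<^sup>*"
      using branch_sym[OF T(2) d(1)] by (auto simp: branch_def)
    then have "(c, s) \<in> (arcs_avoiding T b)\<^sup>*"
    proof induction
      case base then show ?case using cd by blast
    next
      case (step y z)
      have "y \<in> branch T c t'" "z \<in> branch T c t'"
        using step(1,2) branch_sym[OF T(2) d(1)]
        by (auto simp: branch_def intro: rtrancl_into_rtrancl)
      then have "(y, z) \<in> arcs_avoiding T b"
        using b step(2) by (auto simp: arcs_avoiding_def)
      then show ?case using step.IH by (rule rtrancl_into_rtrancl[rotated])
    qed
    then show "s \<in> branch T b t" using c(1) by (auto simp: branch_def intro: rtrancl_trans)
  qed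
  show "branch T c t' \<noteq> branch T b t" using c(1) branch_not_centre[OF t'(2)] by blast
qed

text \<open>Among the heavy branches a smallest one has an attachment node all of whose branches are light:
  a heavy branch there would be disjoint from the first one or strictly contained in it.\<close>

lemma central_bag:
  obtains (central) b where "b \<in> pverts T"
    "\<And>t. t \<in> pverts T \<Longrightarrow> t \<noteq> b \<Longrightarrow> 2 * card (branch_weight T \<beta> b t) \<le> card (pverts G)"
proof (rule ccontr)
  note T = decomposition_tree
  define heavy where "heavy = (\<lambda>(b, t). b \<in> pverts T \<and> t \<in> pverts T \<and> t \<noteq> b \<and>
      card (pverts G) < 2 * card (branch_weight T \<beta> b t))"
  assume no: "\<not> thesis"
  have ex: "\<exists>t. heavy (b, t)" if "b \<in> pverts T" for b
  proof (rule ccontr)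
    assume "\<nexists>t. heavy (b, t)"
    then have "2 * card (branch_weight T \<beta> b t) \<le> card (pverts G)" if "t \<in> pverts T" "t \<noteq> b" for t
      using that \<open>b \<in> pverts T\<close> by (auto simp: heavy_def not_less)
    then show False using central no \<open>b \<in> pverts T\<close> by blast
  qed
  then obtain x where "heavy x" using decomposition_tree_nonempty by blast
  then obtain b t where bt: "heavy (b, t)"
    and least: "\<And>c t'. heavy (c, t') \<Longrightarrow> card (branch T b t) \<le> card (branch T c t')"
    using arg_min_nat_lemma[of heavy x "\<lambda>(b, t). card (branch T b t)"]
    by (metis (no_types, lifting) case_prod_conv surj_pair)
  have V: "b \<in> pverts T" "t \<in> pverts T" "t \<noteq> b" using bt by (auto simp: heavy_def)
  then have "(t, b) \<in> (parcs T)\<^sup>*" using undirected_tree_reach[OF T(1)] by blast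
  then obtain c where c: "c \<in> branch T b t" "(c, b) \<in> parcs T"
    using branch_attachment V(3) by metis
  have "c \<in> pverts T" "c \<noteq> b" using c(2) T(2) by (auto simp: pair_graph_iff irrefl_def)
  then obtain t' where t': "heavy (c, t')" using ex by blast
  then have V': "t' \<in> pverts T" "t' \<noteq> c" by (auto simp: heavy_def)
  show False
  proof (cases "b \<in> branch T c t'")
    case True
    let ?D = "branch_weight T \<beta> b t" and ?D' = "branch_weight T \<beta> c t'"
    have fin: "finite (pverts G)" using G by (simp add: pair_graph_iff)
    have sub: "?D \<subseteq> pverts G" "?D' \<subseteq> pverts G" using branch_weight_subset V V' by auto
    have "card ?D + card ?D' = card (?D \<union> ?D')"
      using opposite_branches_disjoint[OF c(2) V(2) V'(1) c(1) True] sub fin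
      by (intro card_Un_disjoint[symmetric]) (auto intro: finite_subset)
    also have "\<dots> \<le> card (pverts G)" using sub fin by (intro card_mono) auto
    finally show False using bt t' by (simp add: heavy_def)
  next
    case False
    then have "branch T c t' \<subset> branch T b t"
      using branch_shrinks c V' \<open>c \<noteq> b\<close> by blast
    moreover have "finite (branch T b t)"
      using branch_subset_pverts[OF T(2) V(2)] finite_decomposition_tree finite_subset by blast
    ultimately have "card (branch T c t') < card (branch T b t)" by (rule psubset_card_mono[rotated])
    then show False using least[OF t'] by simp
  qed
qed

end

section \<open>Expansion forces large bags\<close>

text \<open>If the family without \<open>D\<close> reaches a sixth of \<open>n\<close>, induction
  applies; if \<open>D\<close> does, it works alone; otherwise the whole union stays below a third.
  The sets may overlap.\<close>

lemma balanced_subfamily: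
  assumes "finite F" "\<And>D. D \<in> F \<Longrightarrow> finite D"
    and "\<And>D. D \<in> F \<Longrightarrow> 2 * card D \<le> n" and "n \<le> 6 * card (\<Union> F)"
  obtains F' where "F' \<subseteq> F" "n \<le> 6 * card (\<Union> F')" "2 * card (\<Union> F') \<le> n"
proof -
  have "\<exists>F' \<subseteq> F. n \<le> 6 * card (\<Union> F') \<and> 2 * card (\<Union> F') \<le> n"
    using assms
  proof (induction F rule: finite_induct)
    case empty then show ?case by simp
  next
    case (insert D F)
    consider "n \<le> 6 * card (\<Union> F)" | "n \<le> 6 * card D"
      | "6 * card (\<Union> F) < n" "6 * card D < n" by linarith
    then show ?case
    proof cases
      case 1
      then obtain F' where "F' \<subseteq> F" "n \<le> 6 * card (\<Union> F')" "2 * card (\<Union> F') \<le> n"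
        using insert.IH insert.prems(1,2) by auto
      then show ?thesis by blast
    next
      case 2
      then show ?thesis using insert.prems(2)[of D] by (intro exI[of _ "{D}"]) auto
    next
      case 3
      have "card (\<Union> (insert D F)) \<le> card D + card (\<Union> F)" by (simp add: card_Un_le)
      then show ?thesis using 3 insert.prems(3) by (intro exI[of _ "insert D F"]) simp
    qed
  qed
  then show ?thesis using that by blast
qed

text \<open>The bag found is the central one. If it has half of the vertices,
  \<open>k \<le> 1\<close> suffices; otherwise a union of pieces with at least a sixth of the
  vertices yields the factor \<open>k / 6\<close>.\<close>

lemma expands_imp_large_bag:
  assumes G: "pair_graph G" and td: "tree_decomposition G T \<beta>"
    and exp: "expands k G" and k: "0 < k" "k \<le> 1"
  obtains b where "b \<in> pverts T" "k / 6 * real (card (pverts G)) \<le> real (card (\<beta> b))"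
proof -
  let ?n = "card (pverts G)"
  note T = decomposition_tree[OF G td]
  have fin: "finite (pverts G)" using G by (simp add: pair_graph_iff)
  obtain b where b: "b \<in> pverts T"
    and light: "\<And>t. t \<in> pverts T \<Longrightarrow> t \<noteq> b \<Longrightarrow> 2 * card (branch_weight T \<beta> b t) \<le> ?n"
    using central_bag[OF G td] by metis
  have bag: "\<beta> b \<subseteq> pverts G" using bag_subset[OF G td b] .
  then have finb: "finite (\<beta> b)" using fin finite_subset by blast
  let ?F = "branch_weight T \<beta> b ` (pverts T - {b})"
  have "k / 6 * real ?n \<le> real (card (\<beta> b))"
  proof (cases "?n \<le> 2 * card (\<beta> b)")
    case True
    have "k / 6 * real ?n \<le> 1 / 6 * real ?n" using k by (intro mult_right_mono) auto
    then show ?thesis using True by linarith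
  next
    case False
    have "pverts G - \<beta> b \<subseteq> \<Union> ?F"
    proof
      fix v assume v: "v \<in> pverts G - \<beta> b"
      then obtain t where "t \<in> pverts T" "v \<in> \<beta> t"
        using td by (auto simp: tree_decomposition_def)
      then show "v \<in> \<Union> ?F"
        using v by (auto simp: branch_weight_def branch_def intro!: bexI[of _ t])
    qed
    moreover have "\<Union> ?F \<subseteq> pverts G" using branch_weight_subset[OF G td] by blast
    ultimately have "card (pverts G - \<beta> b) \<le> card (\<Union> ?F)"
      using fin by (meson card_mono finite_subset)
    \<comment> \<open>The pieces cover more than half of the vertices, well above the sixth asked
      for by \<open>balanced_subfamily\<close>.\<close>
    then have "?n \<le> 6 * card (\<Union> ?F)"
      using False card_Diff_subset[OF finb bag] by linarith
    moreover have "finite ?F" using finite_decomposition_tree[OF G td] by simp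
    moreover have "finite D" if "D \<in> ?F" for D
      using that branch_weight_subset[OF G td] fin finite_subset by blast
    moreover have "2 * card D \<le> ?n" if "D \<in> ?F" for D
      using that light by blast
    ultimately obtain F' where F': "F' \<subseteq> ?F" "?n \<le> 6 * card (\<Union> F')" "2 * card (\<Union> F') \<le> ?n"
      using balanced_subfamily[of ?F ?n] by metis
    have "\<Union> F' \<subseteq> pverts G" using F'(1) branch_weight_subset[OF G td] by blast
    then have "k * real (card (\<Union> F')) \<le> real (card (open_nbhd G (\<Union> F')))"
      using exp F'(3) by (simp add: expands_def)
    \<comment> \<open>All pieces are bounded by the same bag, so their union is too.\<close>
    moreover have "open_nbhd G (\<Union> F') \<subseteq> \<beta> b"
      using F'(1) branch_weight_boundary[OF G td] unfolding open_nbhd_def by blast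
    then have "card (open_nbhd G (\<Union> F')) \<le> card (\<beta> b)" using finb by (rule card_mono[rotated])
    moreover have "k / 6 * real ?n \<le> k / 6 * (6 * real (card (\<Union> F')))"
      using F'(2) k by (intro mult_left_mono) linarith+
    ultimately show ?thesis by simp
  qed
  with b show ?thesis by (rule that)
qed

section \<open>Lower bounds on treewidth\<close>

lemma trivial_tree_decomposition:
  assumes "pair_graph G"
  shows "tree_decomposition G \<lparr>pverts = {t}, parcs = {}\<rparr> (\<lambda>_. pverts G)"
proof -
  let ?T = "\<lparr>pverts = {t}, parcs = {}\<rparr>"
  have *: "connected (with_proj ?T)" "connected (with_proj ?T \<restriction> {t})"
    by (auto simp: connected_def strongly_connected_def reachable_def)
  have T: "pair_graph ?T" by (simp add: pair_graph_iff irrefl_def sym_def)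
  have "\<not> pre_digraph.cycle (with_proj ?T) p" for p
    by (cases p) (simp_all add: pre_digraph.cycle_def pre_digraph.awalk_def)
  then have "undirected_tree ?T"
    using *(1) T by (simp add: undirected_tree_def)
  then show ?thesis
    using assms * by (auto simp: tree_decomposition_def pair_graph_iff)
qed

text \<open>The one-bag decomposition makes the set of widths non-empty, so a common lower bound
  passes to its \<open>Inf\<close>. Widths being integers, \<open>x\<close> is rounded up
  first.\<close>

lemma treewidth_geI:
  assumes "pair_graph G"
    and "\<And>(T :: nat pair_pre_digraph) \<beta>. tree_decomposition G T \<beta> \<Longrightarrow>
      x \<le> real_of_int (decomposition_width T \<beta>)"
  shows "x \<le> real_of_int (treewidth G)"
proof -
  have "\<lceil>x\<rceil> \<le> treewidth G"
    unfolding treewidth_def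
  proof (rule cInf_greatest)
    show "{decomposition_width T \<beta> |(T :: nat pair_pre_digraph) \<beta>. tree_decomposition G T \<beta>} \<noteq> {}"
      using trivial_tree_decomposition[OF assms(1), of "0 :: nat"]
      by (metis (mono_tags, lifting) empty_Collect_eq)
  next
    fix w
    assume "w \<in> {decomposition_width T \<beta> |(T :: nat pair_pre_digraph) \<beta>. tree_decomposition G T \<beta>}"
    then obtain T :: "nat pair_pre_digraph" and \<beta>
      where "w = decomposition_width T \<beta>" "tree_decomposition G T \<beta>"
      by (elim CollectE exE conjE)
    then show "\<lceil>x\<rceil> \<le> w" using assms(2) by (simp only: ceiling_le_iff)
  qed
  then show ?thesis by (simp add: ceiling_le_iff)
qed

lemma card_bag_le_width:
  assumes "pair_graph G" "tree_decomposition G T \<beta>" "t \<in> pverts T"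
  shows "int (card (\<beta> t)) \<le> decomposition_width T \<beta> + 1"
  using Max_ge[of "(\<lambda>t. card (\<beta> t)) ` pverts T" "card (\<beta> t)"]
    finite_decomposition_tree[OF assms(1,2)] assms(3)
  by (simp add: decomposition_width_def)

text \<open>A large bag only bounds the width plus one. Expansion also provides an edge, so the
  width is at least 1 and hence at least half of the width plus one; this halves
  \<open>k / 6\<close>. A single vertex has treewidth 0, whence \<open>two\<close>.\<close>

lemma treewidth_ge_expansion:
  assumes G: "pair_graph G" and exp: "expands k G" and k: "0 < k" "k \<le> 1"
    and two: "2 \<le> card (pverts G)"
  shows "k / 12 * real (card (pverts G)) \<le> real_of_int (treewidth G)"
proof (rule treewidth_geI[OF G])
  fix T :: "nat pair_pre_digraph" and \<beta>
  assume td: "tree_decomposition G T \<beta>"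
  let ?w = "decomposition_width T \<beta>"
  have fin: "finite (pverts G)" using G by (simp add: pair_graph_iff)
  obtain u where u: "u \<in> pverts G" using two by fastforce
  \<comment> \<open>By \<open>two\<close>, a singleton is at most half of the vertices, so
    \<open>u\<close> has a neighbour.\<close>
  have "k * real (card {u}) \<le> real (card (open_nbhd G {u}))"
    using exp u two unfolding expands_def by (intro exp[unfolded expands_def, rule_format]) auto
  then have "open_nbhd G {u} \<noteq> {}" using k by auto
  then obtain v where v: "(u, v) \<in> parcs G" "u \<noteq> v" by (auto simp: open_nbhd_def)
  then obtain t where t: "t \<in> pverts T" "{u, v} \<subseteq> \<beta> t"
    using td by (fastforce simp: tree_decomposition_def)
  have "card {u, v} \<le> card (\<beta> t)"
    using t bag_subset[OF G td t(1)] fin by (intro card_mono) (auto intro: finite_subset)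
  then have one: "1 \<le> ?w" using v(2) card_bag_le_width[OF G td t(1)] by simp
  obtain b where b: "b \<in> pverts T" "k / 6 * real (card (pverts G)) \<le> real (card (\<beta> b))"
    using expands_imp_large_bag[OF G td exp k] by metis
  have "real (card (\<beta> b)) \<le> real_of_int (?w + 1)"
    using card_bag_le_width[OF G td b(1)] by linarith
  then show "k / 12 * real (card (pverts G)) \<le> real_of_int ?w"
    using one b(2) by linarith
qed

section \<open>Application to the three products of classes\<close>

lemma subgraph_cartesian_product:
  assumes "pair_graph G" "pair_graph H"
    and "pr \<in> {cartesian_product, strong_product, lexicographic_product}"
  shows "subgraph (with_proj (cartesian_product G H)) (with_proj (pr G H))"
proof -
  have "pair_graph (pr G H)" "pair_graph (cartesian_product G H)"
    using pair_graph_products[OF assms(1,2)] assms(3) by auto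
  then have "wf_digraph (with_proj (pr G H))" "wf_digraph (with_proj (cartesian_product G H))"
    by (auto simp: wf_digraph_wp_iff pair_graph_iff pair_wf_digraph_def)
  moreover have "parcs (cartesian_product G H) \<subseteq> parcs (pr G H)"
    using assms unfolding pair_graph_iff
    by (auto simp: cartesian_product_def strong_product_def lexicographic_product_def)
  moreover have "pverts (cartesian_product G H) = pverts (pr G H)"
    using assms(3)
    by (auto simp: cartesian_product_def strong_product_def lexicographic_product_def)
  ultimately show ?thesis by (simp add: subgraph_def compatible_def)
qed

text \<open>The class expansion may be infinite, so \<open>k\<close> is taken as a real strictly
  between 0 and it.\<close>

lemma positive_vertex_expansion_expands:
  assumes "positive_vertex_expansion \<G>"
  obtains k where "0 < k" "\<And>G. G \<in> \<G> \<Longrightarrow> expands k G"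
proof -
  have "0 < class_vertex_expansion \<G>" using assms(1) by (simp add: positive_vertex_expansion_def)
  then obtain k where k: "0 < ereal k" "ereal k < class_vertex_expansion \<G>"
    using ereal_dense2 by blast
  have "expands k G" if "G \<in> \<G>" for G
  proof -
    have "class_vertex_expansion \<G> \<le> vertex_expansion G"
      unfolding class_vertex_expansion_def using that by (rule INF_lower)
    then show ?thesis
      using k(2) by (simp add: expands_iff_vertex_expansion)
  qed
  with k(1) show ?thesis by (intro that[of k]) auto
qed

text \<open>Products with at most one vertex are set apart: an empty one has treewidth -1, and a
  single vertex has no subgraph of positive treewidth, so no \<open>c > 0\<close> fits them.\<close>

theorem theorem16:
  fixes \<G> :: "'a pair_pre_digraph set" and \<H> :: "'b pair_pre_digraph set"
    and pr :: "'a pair_pre_digraph \<Rightarrow> 'b pair_pre_digraph \<Rightarrow> ('a \<times> 'b) pair_pre_digraph"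
  assumes "pr \<in> {cartesian_product, strong_product, lexicographic_product}"
    and "\<forall>G \<in> \<G>. pair_graph G" and "\<forall>H \<in> \<H>. pair_graph H"
    and "positive_vertex_expansion \<G>" and "positive_vertex_expansion \<H>"
  shows "\<exists>c::real. c > 0 \<and>
    (\<forall>P \<in> class_product pr \<G> \<H>. 2 \<le> card (pverts P) \<longrightarrow>
      (\<exists>S. pair_graph S \<and> subgraph (with_proj S) (with_proj P) \<and>
        real_of_int (treewidth S) \<ge> c * real (card (pverts P)) \<and>
        real (card (pverts S)) \<ge> c * real (card (pverts P)) - 1 \<and>
        vertex_expansion S \<ge> ereal c))"
proof -
  obtain k1 where k1: "0 < k1" "\<And>G. G \<in> \<G> \<Longrightarrow> expands k1 G"
    using positive_vertex_expansion_expands assms by blast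
  obtain k2 where k2: "0 < k2" "\<And>H. H \<in> \<H> \<Longrightarrow> expands k2 H"
    using positive_vertex_expansion_expands assms by blast
  \<comment> \<open>A common constant for both classes, capped at 1 as the expansion lemmas
    require.\<close>
  define k where "k = Min {1, k1, k2}"
  have k: "0 < k" "k \<le> 1" "k \<le> k1" "k \<le> k2" using k1(1) k2(1) by (auto simp: k_def)
  show ?thesis
  \<comment> \<open>\<open>2400 = 200 * 12\<close>: the product costs a factor 200, the passage to
    treewidth a factor 12.\<close>
  proof (intro exI[of _ "k / 2400"] conjI ballI impI)
    show "k / 2400 > 0" using k(1) by simp
    fix P assume "P \<in> class_product pr \<G> \<H>" and two: "2 \<le> card (pverts P)"
    then obtain G H where P: "P = pr G H" and GH: "G \<in> \<G>" "H \<in> \<H>"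
      by (auto simp: class_product_def)
    have gr: "pair_graph G" "pair_graph H" using GH assms(2,3) by auto
    let ?S = "cartesian_product G H"
    have S: "pair_graph ?S" using pair_graph_products[OF gr] by blast
    have V: "pverts ?S = pverts P"
      using assms(1) unfolding P
      by (auto simp: cartesian_product_def strong_product_def lexicographic_product_def)
    have exp: "expands (k / 200) ?S"
      using gr GH k k1(2) k2(2) by (intro expands_cartesian_product) (auto intro: expands_mono)
    have "k / 200 / 12 * real (card (pverts ?S)) \<le> real_of_int (treewidth ?S)"
      using treewidth_ge_expansion[OF S exp] k two V by simp
    moreover have "k / 2400 * real (card (pverts P)) - 1 \<le> real (card (pverts ?S))"
      using mult_right_mono[of "k / 2400" 1 "real (card (pverts P))"] k V by simp
    moreover have "ereal (k / 2400) \<le> vertex_expansion ?S"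
      using expands_mono[OF exp, of "k / 2400"] k(1) by (simp flip: expands_iff_vertex_expansion)
    ultimately show "\<exists>S. pair_graph S \<and> subgraph (with_proj S) (with_proj P) \<and>
        real_of_int (treewidth S) \<ge> k / 2400 * real (card (pverts P)) \<and>
        real (card (pverts S)) \<ge> k / 2400 * real (card (pverts P)) - 1 \<and>
        vertex_expansion S \<ge> ereal (k / 2400)"
      using S V subgraph_cartesian_product[OF gr assms(1)] P by (intro exI[of _ ?S]) simp
  qed
qed

end
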